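(* Let $H$ be a real Hilbert space and let $S\subset \mathbb{P}(H)$ be a set that does not change its isometry type under spherical projections. Then $S$ can be represented as a disjoint union $S=\bigcup_{\alpha\in I} S_\alpha$ of pairwise orthogonal sets $S_\alpha$, $\alpha\in I$, such that each $S_\alpha$ (with the metric $\rho$) is isometric either to a subset of the helix or to an exceptional quadruple.
   Context: For a real Hilbert space $H$, let $\mathbb{S}(H)=\{x\in H:\|x\|=1\}$ and let $\mathbb{P}(H)=\mathbb{S}(H)/\pm$ be obtained by identifying $x$ and $-x$ for all $x\in\mathbb{S}(H)$; its elements are denoted $\pm x$. It carries the metric $\rho(\pm x,\pm y)=\arccos|\langle x,y\rangle|$. For $x_0\in\mathbb{S}(H)$ let $x_0^\perp=\{x\in H:\langle x,x_0\rangle=0\}$. The spherical projection $p_{\pm x_0}:\mathbb{P}(H)\setminus\{\pm x_0\}\to\mathbb{P}(x_0^\perp)$ is $$p_{\pm x_0}(\pm y)=\pm\frac{y-x_0\langle x_0,y\rangle}{\sqrt{1-\langle x_0,y\rangle^2}}.$$ A set $S\subset\mathbb{P}(H)$ does not change its isometry type under spherical projections if for all $\pm s_0\in S$ and all $\pm x,\pm y\in S\setminus\{\pm s_0\}$ one has $\rho(p_{\pm s_0}(\pm x),p_{\pm s_0}(\pm y))=\rho(\pm x,\pm y)$. Sets $S_\alpha,S_\beta\subset\mathbb{P}(H)$ are orthogonal if $\langle u,v\rangle=0$ for all $\pm u\in S_\alpha$, $\pm v\in S_\beta$. Helix: a set $\{h(t)\}_{t\in\mathbb{R}}$ of points of an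 infinite-dimensional projective Hilbert space (not necessarily $\mathbb{P}(H)$) with $|\langle h(s),h(t)\rangle|=\frac{1}{\cosh(t-s)}$ for all $s,t\in\mathbb{R}$. (Such a set exists, and it is unique up to isometry with respect to the metric $\rho$.) Exceptional quadruple: a set $\{\pm A,\pm B,\pm C,\pm D\}$ in a projective Hilbert space, where $A,B,C,D$ are unit vectors with $$\langle A,B\rangle=\langle C,D\rangle=\frac1{\cosh x},\quad \langle A,D\rangle=\langle B,C\rangle=\frac1{\cosh y},\quad \langle A,C\rangle=\langle B,D\rangle=\frac1{\cosh(x-y)},$$ for some distinct numbers $x>0$, $y>0$ for which the resulting $4\times4$ Gram matrix (with unit diagonal) is positive semi-definite. *)

theory Defs
  imports "HOL-Analysis.Analysis"
begin

section \<open>Projective Hilbert spaces\<close>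

definition antipodal :: "'a::real_inner set \<Rightarrow> ('a \<times> 'a) set" where
  "antipodal V = {(x, y). x \<in> V \<inter> sphere 0 1 \<and> y \<in> V \<inter> sphere 0 1 \<and> (y = x \<or> y = - x)}"

text \<open>
  The quotient is formed for a linear subspace \<open>V\<close> of the ambient Hilbert space rather than for a
  type, because the projections take their values in the projective space of \<open>x\<^sub>0\<^sup>\<bottom>\<close>, and because
  the space \<open>{0}\<close> has an empty projective space. A point is a set of the form \<open>{x, - x}\<close>.
\<close>

definition proj_space :: "'a::real_inner set \<Rightarrow> 'a set set" where
  "proj_space V = (V \<inter> sphere 0 1) // antipodal V"

definition pm :: "'a::real_inner \<Rightarrow> 'a set" where
  "pm x = {x, - x}"

definition orth_compl :: "'a::real_inner set \<Rightarrow> 'a set" where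
  "orth_compl p = {x. \<forall>x0\<in>p. x \<bullet> x0 = 0}"

text \<open>
  In the next two definitions the representatives run over whole classes; the results do not depend
  on them, see \<open>rho_pm\<close> and \<open>sph_proj_pm\<close>.
\<close>

definition rho :: "'a::real_inner set \<Rightarrow> 'a set \<Rightarrow> real" where
  "rho p q = (THE r. \<exists>x\<in>p. \<exists>y\<in>q. r = arccos \<bar>x \<bullet> y\<bar>)"

definition sph_proj :: "'a::real_inner set \<Rightarrow> 'a set \<Rightarrow> 'a set" where
  "sph_proj p q = {(y - (x0 \<bullet> y) *\<^sub>R x0) /\<^sub>R sqrt (1 - (x0 \<bullet> y)\<^sup>2) | x0 y. x0 \<in> p \<and> y \<in> q}"

lemma equiv_antipodal: "subspace V \<Longrightarrow> equiv (V \<inter> sphere 0 1) (antipodal V)"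
  by (auto simp: equiv_def refl_on_def sym_def trans_def antipodal_def subspace_neg)

lemma proj_space_eq: "subspace V \<Longrightarrow> proj_space V = pm ` (V \<inter> sphere 0 1)"
  by (auto simp: proj_space_def quotient_def antipodal_def pm_def subspace_neg image_iff
      intro!: bexI)

lemma subspace_orth_compl: "subspace (orth_compl p)"
  by (auto simp: subspace_def orth_compl_def inner_add_left)

lemma pm_eq_iff: "pm x = pm y \<longleftrightarrow> y = x \<or> y = - x"
  by (auto simp: pm_def doubleton_eq_iff)

lemma rho_pm: "rho (pm x) (pm y) = arccos \<bar>x \<bullet> y\<bar>"
  unfolding rho_def pm_def by (rule the_equality) auto

lemma sph_proj_pm:
  "sph_proj (pm x0) (pm y) = pm ((y - (x0 \<bullet> y) *\<^sub>R x0) /\<^sub>R sqrt (1 - (x0 \<bullet> y)\<^sup>2))"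
proof -
  define g where "g a b = (b - (a \<bullet> b) *\<^sub>R a) /\<^sub>R sqrt (1 - (a \<bullet> b)\<^sup>2)" for a b :: 'a
  have g1: "g (- a) b = g a b" for a b by (simp add: g_def)
  have g2: "g a (- b) = - g a b" for a b
  proof -
    have e: "- b - (a \<bullet> - b) *\<^sub>R a = - (b - (a \<bullet> b) *\<^sub>R a)" by simp
    then show ?thesis unfolding g_def e by (simp only: inner_minus_right power2_minus scaleR_minus_right)
  qed
  have "sph_proj (pm x0) (pm y) = {g a b | a b. a \<in> pm x0 \<and> b \<in> pm y}"
    by (simp add: sph_proj_def g_def)
  also have "\<dots> = {g x0 y, g x0 (- y), g (- x0) y, g (- x0) (- y)}"
    unfolding pm_def by blast
  also have "\<dots> = pm (g x0 y)"
    by (simp add: g1 g2 pm_def insert_commute)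
  finally show ?thesis unfolding g_def .
qed

lemma sph_proj_in_proj_space:
  assumes p: "p \<in> proj_space UNIV" and q: "q \<in> proj_space UNIV - {p}"
  shows "sph_proj p q \<in> proj_space (orth_compl p)"
proof -
  obtain x where x: "p = pm x" "norm x = 1" using p by (auto simp: proj_space_eq)
  obtain y where y: "q = pm y" "norm y = 1"
    using DiffD1[OF q] by (auto simp: proj_space_eq)
  let ?w = "y - (x \<bullet> y) *\<^sub>R x" and ?c = "x \<bullet> y"
  have xx: "x \<bullet> x = 1" and yy: "y \<bullet> y = 1"
    using x(2) y(2) by (simp_all add: dot_square_norm)
  have ww: "?w \<bullet> ?w = 1 - ?c\<^sup>2"
    by (simp add: inner_diff_left inner_diff_right xx yy inner_commute[of y x] power2_eq_square)
  have "?w \<noteq> 0"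
  proof
    assume "?w = 0"
    then have e: "y = ?c *\<^sub>R x" by simp
    then have "\<bar>?c\<bar> = 1" using x(2) y(2) by (metis norm_scaleR mult.right_neutral)
    then have "y = x \<or> y = - x" using e by (metis abs_1 abs_eq_iff scaleR_minus_left scaleR_one)
    then show False using q x(1) y(1) by (auto simp: pm_eq_iff)
  qed
  then have pos: "1 - ?c\<^sup>2 > 0" using ww by (metis inner_gt_zero_iff)
  have "norm ?w = sqrt (1 - ?c\<^sup>2)" using ww by (simp add: norm_eq_sqrt_inner)
  then have n: "norm (?w /\<^sub>R sqrt (1 - ?c\<^sup>2)) = 1" using pos by simp
  have o: "?w /\<^sub>R sqrt (1 - ?c\<^sup>2) \<in> orth_compl p"
    by (auto simp: orth_compl_def x(1) pm_def inner_diff_left xx inner_commute[of y x])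
  show ?thesis
    unfolding proj_space_eq[OF subspace_orth_compl] x(1) y(1) sph_proj_pm
    by (rule imageI) (use n o x(1) in simp)
qed

definition proj_invariant :: "'a::real_inner set set \<Rightarrow> bool" where
  "proj_invariant S \<longleftrightarrow>
     (\<forall>s\<in>S. \<forall>p\<in>S - {s}. \<forall>q\<in>S - {s}. rho (sph_proj s p) (sph_proj s q) = rho p q)"

definition orthogonal_sets :: "'a::real_inner set set \<Rightarrow> 'a set set \<Rightarrow> bool" where
  "orthogonal_sets T U \<longleftrightarrow> (\<forall>p\<in>T. \<forall>q\<in>U. \<forall>u\<in>p. \<forall>v\<in>q. u \<bullet> v = 0)"

definition isometric :: "'a::real_inner set set \<Rightarrow> 'b::real_inner set set \<Rightarrow> bool" where
  "isometric T U \<longleftrightarrow>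
     (\<exists>f. bij_betw f T U \<and> (\<forall>p\<in>T. \<forall>q\<in>T. rho (f p) (f q) = rho p q))"

section \<open>The helix and the exceptional quadruples\<close>

definition is_helix :: "'a::{real_inner, complete_space} set set \<Rightarrow> bool" where
  "is_helix K \<longleftrightarrow>
     (\<nexists>B :: 'a set. finite B \<and> span B = UNIV) \<and>
     (\<exists>h :: real \<Rightarrow> 'a set. K = range h \<and> (\<forall>t. h t \<in> proj_space UNIV) \<and>
        (\<forall>s t. \<forall>u\<in>h s. \<forall>v\<in>h t. \<bar>u \<bullet> v\<bar> = 1 / cosh (t - s)))"

definition exc_gram :: "real \<Rightarrow> real \<Rightarrow> real^4^4" where
  "exc_gram x y =
    (let a = 1 / cosh x; b = 1 / cosh y; c = 1 / cosh (x - y) in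
     vector [vector [1, a, c, b],
             vector [a, 1, b, c],
             vector [c, b, 1, a],
             vector [b, c, a, 1]])"

definition pos_semidef :: "real^'n^'n \<Rightarrow> bool" where
  "pos_semidef G \<longleftrightarrow> transpose G = G \<and> (\<forall>v. 0 \<le> v \<bullet> (G *v v))"

definition exceptional_quadruple :: "'a::{real_inner, complete_space} set set \<Rightarrow> bool" where
  "exceptional_quadruple Q \<longleftrightarrow>
     (\<exists>x y. x > 0 \<and> y > 0 \<and> x \<noteq> y \<and> pos_semidef (exc_gram x y) \<and>
       (\<exists>A B C D. A \<in> sphere 0 1 \<and> B \<in> sphere 0 1 \<and> C \<in> sphere 0 1 \<and> D \<in> sphere 0 1 \<and>
          A \<bullet> B = 1 / cosh x \<and> C \<bullet> D = 1 / cosh x \<and>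
          A \<bullet> D = 1 / cosh y \<and> B \<bullet> C = 1 / cosh y \<and>
          A \<bullet> C = 1 / cosh (x - y) \<and> B \<bullet> D = 1 / cosh (x - y) \<and>
          Q = {pm A, pm B, pm C, pm D}))"

lemma vector_4:
  "(vector [a, b, c, d] :: 'a::zero^4) $ 1 = a" "(vector [a, b, c, d] :: 'a^4) $ 2 = b"
  "(vector [a, b, c, d] :: 'a^4) $ 3 = c" "(vector [a, b, c, d] :: 'a^4) $ 4 = d"
  by (simp_all add: vector_def)

text \<open>Positive semidefiniteness holds as soon as the vectors exist.\<close>

lemma pos_semidef_exc_gram:
  assumes "A \<in> sphere 0 1" "B \<in> sphere 0 1" "C \<in> sphere 0 1" "D \<in> sphere 0 1"
    and "A \<bullet> B = 1 / cosh x" "C \<bullet> D = 1 / cosh x" "A \<bullet> D = 1 / cosh y" "B \<bullet> C = 1 / cosh y"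
    and "A \<bullet> C = 1 / cosh (x - y)" "B \<bullet> D = 1 / cosh (x - y)"
  shows "pos_semidef (exc_gram x y)"
  unfolding pos_semidef_def
proof (intro conjI allI)
  show "transpose (exc_gram x y) = exc_gram x y"
    by (simp add: exc_gram_def Let_def transpose_def vec_eq_iff forall_4 vector_4)
next
  fix v :: "real^4"
  let ?w = "v$1 *\<^sub>R A + v$2 *\<^sub>R B + v$3 *\<^sub>R C + v$4 *\<^sub>R D"
  have unit: "A \<bullet> A = 1" "B \<bullet> B = 1" "C \<bullet> C = 1" "D \<bullet> D = 1"
    using assms(1-4) by (simp_all add: dot_square_norm)
  have "v \<bullet> (exc_gram x y *v v) = ?w \<bullet> ?w"
    by (simp add: exc_gram_def Let_def inner_vec_def matrix_vector_mult_def sum_4 vector_4 unit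
        assms(5-10) inner_add_left inner_add_right inner_commute[of B A] inner_commute[of C A]
        inner_commute[of D A] inner_commute[of C B] inner_commute[of D B] inner_commute[of D C]
        algebra_simps)
  then show "0 \<le> v \<bullet> (exc_gram x y *v v)" by simp
qed

lemma is_helixE:
  fixes K :: "'a::{real_inner, complete_space} set set"
  assumes "is_helix K"
  obtains h :: "real \<Rightarrow> 'a set" where "K = range h" "inj h"
    "\<And>s t. rho (h s) (h t) = arccos (1 / cosh (t - s))"
proof -
  obtain h :: "real \<Rightarrow> 'a set" where h: "K = range h" "\<And>t. h t \<in> proj_space UNIV"
    "\<And>s t u v. u \<in> h s \<Longrightarrow> v \<in> h t \<Longrightarrow> \<bar>u \<bullet> v\<bar> = 1 / cosh (t - s)"
  proof -
    obtain h :: "real \<Rightarrow> 'a set" where "K = range h \<and> (\<forall>t. h t \<in> proj_space UNIV) \<and>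
      (\<forall>s t. \<forall>u\<in>h s. \<forall>v\<in>h t. \<bar>u \<bullet> v\<bar> = 1 / cosh (t - s))"
      using assms unfolding is_helix_def by (elim conjE exE) (rule that, intro conjI)
    then show thesis by (intro that[of h]) simp_all
  qed
  have "\<exists>u. h t = pm u \<and> norm u = 1" for t
    using h(2)[of t] by (auto simp: proj_space_eq)
  then obtain k where k: "\<And>t. h t = pm (k t)" "\<And>t. norm (k t) = 1" by metis
  have kh: "k t \<in> h t" for t by (simp add: k(1) pm_def)
  have ip: "\<bar>k s \<bullet> k t\<bar> = 1 / cosh (t - s)" for s t by (rule h(3)[OF kh kh])
  have "inj h"
  proof (rule injI)
    fix s t assume "h s = h t"
    then have "k s \<in> h t" using kh[of s] by simp
    then have "\<bar>k s \<bullet> k s\<bar> = 1 / cosh (t - s)" by (rule h(3)[OF kh])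
    moreover have "k s \<bullet> k s = 1" using k(2)[of s] by (simp add: dot_square_norm)
    ultimately have "cosh (t - s) = 1" by simp
    then show "s = t" by simp
  qed
  moreover have "rho (h s) (h t) = arccos (1 / cosh (t - s))" for s t
    unfolding k(1) rho_pm ip ..
  ultimately show thesis using that h(1) by blast
qed

lemma helix_unique:
  fixes K :: "'a::{real_inner, complete_space} set set"
    and L :: "'b::{real_inner, complete_space} set set"
  assumes "is_helix K" "is_helix L"
  shows "isometric K L"
proof -
  obtain h :: "real \<Rightarrow> 'a set" where h: "K = range h" "inj h"
    "\<And>s t. rho (h s) (h t) = arccos (1 / cosh (t - s))"
    using is_helixE[OF assms(1)] by blast
  obtain g :: "real \<Rightarrow> 'b set" where g: "L = range g" "inj g"
    "\<And>s t. rho (g s) (g t) = arccos (1 / cosh (t - s))"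
    using is_helixE[OF assms(2)] by blast
  have "bij_betw (g \<circ> inv h) K L"
    unfolding h(1) g(1)
    by (rule bij_betw_trans[OF inj_imp_bij_betw_inv[OF h(2)]])
      (rule inj_on_imp_bij_betw[OF g(2)])
  moreover have "rho ((g \<circ> inv h) p) ((g \<circ> inv h) q) = rho p q" if pq: "p \<in> K" "q \<in> K" for p q
  proof -
    obtain s t where "p = h s" "q = h t" using pq h(1) by blast
    then show ?thesis by (simp add: inv_f_f[OF h(2)] h(3) g(3))
  qed
  ultimately show ?thesis unfolding isometric_def by blast
qed

section \<open>The Hilbert space of square-summable sequences\<close>

text \<open>
  The ambient space of the helix and of the exceptional quadruples. Since a statement cannot
  quantify existentially over types, one fixed model is needed; nothing is lost, because every
  exceptional quadruple of any Hilbert space lies in a subspace of dimension at most four,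
  which embeds isometrically into this one, and the helix is unique up to isometry.
\<close>

typedef ell2 = "{f :: nat \<Rightarrow> real. summable (\<lambda>n. (f n)\<^sup>2)}"
  morphisms seq_of Ell2
  by (rule exI[of _ "\<lambda>_. 0"]) simp

setup_lifting type_definition_ell2

lemma summable_seq_of: "summable (\<lambda>n. (seq_of f n)\<^sup>2)"
  using seq_of by blast

lemma square_summable_mult:
  fixes f g :: "nat \<Rightarrow> real"
  assumes "summable (\<lambda>n. (f n)\<^sup>2)" "summable (\<lambda>n. (g n)\<^sup>2)"
  shows "summable (\<lambda>n. f n * g n)"
proof (rule summable_comparison_test'[OF summable_add[OF assms]])
  fix n :: nat
  have "2 * \<bar>f n * g n\<bar> \<le> (f n)\<^sup>2 + (g n)\<^sup>2"
    using sum_squares_bound[of "\<bar>f n\<bar>" "\<bar>g n\<bar>"] by (simp add: abs_mult)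
  then show "norm (f n * g n) \<le> (f n)\<^sup>2 + (g n)\<^sup>2"
    by simp
qed

lemma square_summable_add:
  fixes f g :: "nat \<Rightarrow> real"
  assumes "summable (\<lambda>n. (f n)\<^sup>2)" "summable (\<lambda>n. (g n)\<^sup>2)"
  shows "summable (\<lambda>n. (f n + g n)\<^sup>2)"
proof -
  have "summable (\<lambda>n. ((f n)\<^sup>2 + (g n)\<^sup>2) + 2 * (f n * g n))"
    by (intro summable_add summable_mult square_summable_mult assms)
  then show ?thesis by (simp add: power2_sum mult.assoc)
qed

instantiation ell2 :: real_vector
begin

lift_definition zero_ell2 :: ell2 is "\<lambda>_. 0" by simp

lift_definition plus_ell2 :: "ell2 \<Rightarrow> ell2 \<Rightarrow> ell2" is "\<lambda>f g n. f n + g n"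
  by (rule square_summable_add)

lift_definition uminus_ell2 :: "ell2 \<Rightarrow> ell2" is "\<lambda>f n. - f n" by simp

lift_definition minus_ell2 :: "ell2 \<Rightarrow> ell2 \<Rightarrow> ell2" is "\<lambda>f g n. f n - g n"
  subgoal for f g using square_summable_add[of f "\<lambda>n. - g n"] by simp
  done

lift_definition scaleR_ell2 :: "real \<Rightarrow> ell2 \<Rightarrow> ell2" is "\<lambda>c f n. c * f n"
  by (simp add: power_mult_distrib summable_mult)

instance
  by standard (transfer; simp add: fun_eq_iff algebra_simps)+

end

instantiation ell2 :: real_inner
begin

definition inner_ell2 :: "ell2 \<Rightarrow> ell2 \<Rightarrow> real" where
  "inner_ell2 f g = (\<Sum>n. seq_of f n * seq_of g n)"

definition norm_ell2 :: "ell2 \<Rightarrow> real" where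
  "norm_ell2 f = sqrt (inner f f)"

definition sgn_ell2 :: "ell2 \<Rightarrow> ell2" where
  "sgn_ell2 f = f /\<^sub>R norm f"

definition dist_ell2 :: "ell2 \<Rightarrow> ell2 \<Rightarrow> real" where
  "dist_ell2 f g = norm (f - g)"

definition uniformity_ell2 :: "(ell2 \<times> ell2) filter" where
  "uniformity_ell2 = (INF e\<in>{0 <..}. principal {(x, y). dist x y < e})"

definition open_ell2 :: "ell2 set \<Rightarrow> bool" where
  "open_ell2 U = (\<forall>x\<in>U. eventually (\<lambda>(x', y). x' = x \<longrightarrow> y \<in> U) uniformity)"

instance
proof
  fix f g k :: ell2 and r :: real
  have sm: "summable (\<lambda>n. seq_of f n * seq_of g n)" for f g
    by (intro square_summable_mult summable_seq_of)
  show "dist f g = norm (f - g)" by (simp add: dist_ell2_def)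
  show "sgn f = f /\<^sub>R norm f" by (simp add: sgn_ell2_def)
  show "inner f g = inner g f" by (simp add: inner_ell2_def mult.commute)
  show "inner (f + g) k = inner f k + inner g k"
    by (simp add: inner_ell2_def plus_ell2.rep_eq distrib_right suminf_add[OF sm sm])
  show "inner (r *\<^sub>R f) g = r * inner f g"
    by (simp add: inner_ell2_def scaleR_ell2.rep_eq mult.assoc suminf_mult[OF sm])
  show "0 \<le> inner f f"
    by (simp add: inner_ell2_def suminf_nonneg sm)
  show "(inner f f = 0) = (f = 0)"
    using suminf_eq_zero_iff[OF sm[of f f]]
    by (simp add: inner_ell2_def seq_of_inject[symmetric] zero_ell2.rep_eq fun_eq_iff)
  show "norm f = sqrt (inner f f)" by (simp add: norm_ell2_def)
qed (simp_all add: uniformity_ell2_def open_ell2_def)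

end

lemma ell2_norm_power2: "(norm f)\<^sup>2 = (\<Sum>n. (seq_of f n)\<^sup>2)"
  by (simp add: power2_norm_eq_inner inner_ell2_def power2_eq_square[symmetric])

lemma ell2_partial_le: "(\<Sum>n<N. (seq_of f n)\<^sup>2) \<le> (norm f)\<^sup>2"
  unfolding ell2_norm_power2 by (rule sum_le_suminf) (auto intro: summable_seq_of)

instance ell2 :: complete_space
proof
  fix X :: "nat \<Rightarrow> ell2"
  assume C: "Cauchy X"
  have coord: "\<bar>seq_of f n\<bar> \<le> norm f" for f n
  proof -
    have "(seq_of f n)\<^sup>2 \<le> (\<Sum>k<Suc n. (seq_of f k)\<^sup>2)" by (simp add: sum_nonneg)
    also have "\<dots> \<le> (norm f)\<^sup>2" by (rule ell2_partial_le)
    finally show ?thesis by (simp add: abs_le_square_iff[symmetric])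
  qed
  have "\<exists>l. (\<lambda>i. seq_of (X i) n) \<longlonglongrightarrow> l" for n
  proof -
    have "Cauchy (\<lambda>i. seq_of (X i) n)"
    proof (rule metric_CauchyI)
      fix e :: real assume "e > 0"
      then obtain M where M: "\<And>i j. i \<ge> M \<Longrightarrow> j \<ge> M \<Longrightarrow> dist (X i) (X j) < e"
        using metric_CauchyD[OF C] by blast
      have "dist (seq_of (X i) n) (seq_of (X j) n) < e" if "i \<ge> M" "j \<ge> M" for i j
        using coord[of "X i - X j" n] M[OF that]
        by (simp add: dist_norm minus_ell2.rep_eq)
      then show "\<exists>M. \<forall>i\<ge>M. \<forall>j\<ge>M. dist (seq_of (X i) n) (seq_of (X j) n) < e" by blast
    qed
    then show ?thesis by (simp add: Cauchy_convergent_iff convergent_def)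
  qed
  then have "\<exists>l. \<forall>n. (\<lambda>i. seq_of (X i) n) \<longlonglongrightarrow> l n" by (intro choice allI)
  then obtain l where l: "\<And>n. (\<lambda>i. seq_of (X i) n) \<longlonglongrightarrow> l n" by (elim exE) (rule that, rule spec)
  have key: "\<exists>M. \<forall>i\<ge>M. \<forall>N. (\<Sum>n<N. (seq_of (X i) n - l n)\<^sup>2) \<le> e\<^sup>2" if "e > 0" for e :: real
  proof -
    obtain M where M: "\<And>i j. i \<ge> M \<Longrightarrow> j \<ge> M \<Longrightarrow> dist (X i) (X j) < e"
      using metric_CauchyD[OF C \<open>e > 0\<close>] by blast
    have "(\<Sum>n<N. (seq_of (X i) n - l n)\<^sup>2) \<le> e\<^sup>2" if "i \<ge> M" for i N
    proof (rule LIMSEQ_le_const2)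
      show "(\<lambda>j. \<Sum>n<N. (seq_of (X i) n - seq_of (X j) n)\<^sup>2) \<longlonglongrightarrow> (\<Sum>n<N. (seq_of (X i) n - l n)\<^sup>2)"
        by (intro tendsto_sum tendsto_power tendsto_diff tendsto_const l)
      have "(\<Sum>n<N. (seq_of (X i) n - seq_of (X j) n)\<^sup>2) \<le> e\<^sup>2" if "j \<ge> M" for j
      proof -
        have "(\<Sum>n<N. (seq_of (X i) n - seq_of (X j) n)\<^sup>2) \<le> (norm (X i - X j))\<^sup>2"
          using ell2_partial_le[of "X i - X j" N] by (simp add: minus_ell2.rep_eq)
        also have "\<dots> \<le> e\<^sup>2"
          using M[OF \<open>i \<ge> M\<close> that] by (intro power_mono) (simp_all add: dist_norm)
        finally show ?thesis .
      qed
      then show "\<exists>K. \<forall>j\<ge>K. (\<Sum>n<N. (seq_of (X i) n - seq_of (X j) n)\<^sup>2) \<le> e\<^sup>2" by blast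
    qed
    then show ?thesis by blast
  qed
  have sq: "summable (\<lambda>n. (f n)\<^sup>2)" if "\<forall>N. (\<Sum>n<N. (f n)\<^sup>2) \<le> b" for f :: "nat \<Rightarrow> real" and b
    using that by (intro summableI_nonneg_bounded[of _ b]) auto
  obtain M where "\<forall>i\<ge>M. \<forall>N. (\<Sum>n<N. (seq_of (X i) n - l n)\<^sup>2) \<le> 1\<^sup>2"
    using key[OF zero_less_one] ..
  then have "\<forall>N. (\<Sum>n<N. (seq_of (X M) n - l n)\<^sup>2) \<le> 1\<^sup>2" by (elim allE[of _ M]) simp
  then have "summable (\<lambda>n. (seq_of (X M) n - l n)\<^sup>2)" by (rule sq)
  then have "summable (\<lambda>n. (- (seq_of (X M) n - l n))\<^sup>2)"
    by (simp only: power2_minus)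
  then have "summable (\<lambda>n. (- (seq_of (X M) n - l n) + seq_of (X M) n)\<^sup>2)"
    by (rule square_summable_add) (rule summable_seq_of)
  then have "summable (\<lambda>n. (l n)\<^sup>2)" by simp
  then have L: "seq_of (Ell2 l) = l" by (simp add: Ell2_inverse)
  have "X \<longlonglongrightarrow> Ell2 l"
  proof (rule metric_LIMSEQ_I)
    fix e :: real assume "e > 0"
    then have "e/2 > 0" by simp
    from key[OF this] obtain M
      where M: "\<forall>i\<ge>M. \<forall>N. (\<Sum>n<N. (seq_of (X i) n - l n)\<^sup>2) \<le> (e/2)\<^sup>2" ..
    have "dist (X i) (Ell2 l) < e" if i: "i \<ge> M" for i
    proof -
      have b: "(\<Sum>n<N. (seq_of (X i) n - l n)\<^sup>2) \<le> (e/2)\<^sup>2" for N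
        by (rule M[THEN spec, THEN mp, OF i, THEN spec])
      have d: "seq_of (X i - Ell2 l) n = seq_of (X i) n - l n" for n
        unfolding minus_ell2.rep_eq L ..
      have "(\<Sum>n. (seq_of (X i - Ell2 l) n)\<^sup>2) \<le> (e/2)\<^sup>2"
        by (rule suminf_le_const[OF summable_seq_of]) (unfold d, rule b)
      then have "(norm (X i - Ell2 l))\<^sup>2 \<le> (e/2)\<^sup>2"
        unfolding ell2_norm_power2 .
      then have "norm (X i - Ell2 l) \<le> e/2"
        by (rule power2_le_imp_le) (rule less_imp_le[OF \<open>e/2 > 0\<close>])
      also have "e/2 < e" using \<open>e > 0\<close> by simp
      finally show ?thesis unfolding dist_norm .
    qed
    then show "\<exists>M. \<forall>i\<ge>M. dist (X i) (Ell2 l) < e" by (intro exI[of _ M] allI impI)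
  qed
  then show "convergent X" by (rule convergentI)
qed

lemma ell2_infinite_dimensional: "\<nexists>B :: ell2 set. finite B \<and> span B = UNIV"
proof
  assume "\<exists>B :: ell2 set. finite B \<and> span B = UNIV"
  then obtain B :: "ell2 set" where B: "finite B" "span B = UNIV" by blast
  define e where "e k = Ell2 (\<lambda>n. if n = k then 1 else 0)" for k
  have se: "seq_of (e k) = (\<lambda>n. if n = k then 1 else 0)" for k
    unfolding e_def
  proof (rule Ell2_inverse)
    have "summable (\<lambda>n. (if n = k then 1 else 0 :: real)\<^sup>2)"
      by (rule summable_finite[of "{k}"]) simp_all
    then show "(\<lambda>n. if n = k then 1 else 0) \<in> {f :: nat \<Rightarrow> real. summable (\<lambda>n. (f n)\<^sup>2)}"
      by simp
  qed
  have ie: "e j \<bullet> e k = (if j = k then 1 else 0)" for j k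
    unfolding inner_ell2_def se
    by (subst suminf_finite[of "{k}"]) auto
  have "inj e" by (rule injI) (metis ie zero_neq_one)
  have "independent (range e)"
  proof (rule pairwise_orthogonal_independent)
    show "pairwise orthogonal (range e)"
      by (auto simp: pairwise_def orthogonal_def ie)
    show "0 \<notin> range e" by (metis ie imageE inner_zero_left zero_neq_one)
  qed
  then have "finite (range e)"
    using independent_span_bound[of B "range e"] B by simp
  then show False using \<open>inj e\<close> finite_imageD infinite_UNIV_nat by blast
qed

text \<open>
  Existence of the helix: the sequences \<open>tanh t ^ n / cosh t\<close> have the required inner products,
  because \<open>cosh (t - s) = cosh t * cosh s * (1 - tanh t * tanh s)\<close>.
\<close>

lemma helix_exists: "\<exists>K :: ell2 set set. is_helix K"
proof -
  define f where "f t = Ell2 (\<lambda>n. tanh t ^ n / cosh t)" for t :: real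
  have lt: "\<bar>tanh s * tanh t\<bar> < 1" for s t :: real
  proof -
    have "\<bar>tanh s\<bar> < 1" "\<bar>tanh t\<bar> < 1"
      using tanh_real_bounds[of s] tanh_real_bounds[of t] by auto
    then show ?thesis using mult_strict_mono[of "\<bar>tanh s\<bar>" 1 "\<bar>tanh t\<bar>" 1] by (simp add: abs_mult)
  qed
  have prod: "tanh s ^ n / cosh s * (tanh t ^ n / cosh t) = (tanh s * tanh t) ^ n * (1 / (cosh s * cosh t))"
    for s t :: real and n
    by (simp add: power_mult_distrib)
  have sf: "seq_of (f t) = (\<lambda>n. tanh t ^ n / cosh t)" for t
    unfolding f_def
  proof (rule Ell2_inverse)
    have "summable (\<lambda>n. (tanh t * tanh t) ^ n * (1 / (cosh t * cosh t)))"
      by (rule summable_mult2, rule summable_geometric) (use lt[of t t] in \<open>simp only: real_norm_def\<close>)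
    then show "(\<lambda>n. tanh t ^ n / cosh t) \<in> {f. summable (\<lambda>n. (f n)\<^sup>2)}"
      by (simp only: mem_Collect_eq power2_eq_square prod)
  qed
  have ip: "f s \<bullet> f t = 1 / cosh (t - s)" for s t
  proof -
    have "f s \<bullet> f t = (\<Sum>n. (tanh s * tanh t) ^ n) * (1 / (cosh s * cosh t))"
      unfolding inner_ell2_def sf prod
      using lt[of s t] by (intro suminf_mult2[symmetric] summable_geometric) simp
    also have "\<dots> = 1 / (1 - tanh s * tanh t) * (1 / (cosh s * cosh t))"
      using lt[of s t] by (simp add: suminf_geometric)
    also have "\<dots> = 1 / ((1 - tanh s * tanh t) * (cosh s * cosh t))" by simp
    also have "(1 - tanh s * tanh t) * (cosh s * cosh t) = cosh (t - s)"
      by (simp add: cosh_diff tanh_def field_simps)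
    finally show ?thesis .
  qed
  have "norm (f t) = 1" for t by (simp add: norm_eq_sqrt_inner ip)
  then have "is_helix (range (\<lambda>t. pm (f t)))"
    unfolding is_helix_def
    by (intro conjI ell2_infinite_dimensional exI[of _ "\<lambda>t. pm (f t)"])
      (auto simp: proj_space_eq pm_def ip)
  then show ?thesis by blast
qed

end

theory Submission
  imports Defs
begin

text \<open>
  For unit vectors with pairwise inner products \<open>a\<close>, \<open>b\<close>, \<open>c\<close>, invariance under the projection from
  one of them says \<open>a\<^sup>2b\<^sup>2 + b\<^sup>2c\<^sup>2 + c\<^sup>2a\<^sup>2 = 2abc + a\<^sup>2b\<^sup>2c\<^sup>2\<close>. This condition is symmetric. If one of the
  three numbers vanishes then so does a second one, so being non-orthogonal is an equivalence
  relation on \<open>S\<close>. If none vanishes then \<open>abc > 0\<close>, and writing \<open>\<bar>a\<bar> = 1 / cosh \<alpha>\<close> and so on turns the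
  condition into \<open>\<gamma> = \<bar>\<alpha> \<plusminus> \<beta>\<bar>\<close>. Hence on each equivalence class the quantities
  \<open>arcosh (1 / \<bar>x \<bullet> y\<bar>)\<close> form a metric in which every three points are isometric to points of the line.
  By a theorem of Menger such a space is isometric to a subset of the line, which gives a subset of
  the helix, or is a quadruple with equal opposite distances, which is exceptional.
\<close>

section \<open>Metric spaces in which every triple is linear\<close>

locale linear_triples =
  fixes T :: "'b set" and d :: "'b \<Rightarrow> 'b \<Rightarrow> real"
  assumes refl: "x \<in> T \<Longrightarrow> d x x = 0"
    and pos: "x \<in> T \<Longrightarrow> y \<in> T \<Longrightarrow> x \<noteq> y \<Longrightarrow> 0 < d x y"
    and sym: "x \<in> T \<Longrightarrow> y \<in> T \<Longrightarrow> d x y = d y x"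
    and lin: "x \<in> T \<Longrightarrow> y \<in> T \<Longrightarrow> z \<in> T \<Longrightarrow>
      d x z = d x y + d y z \<or> d x y = d x z + d y z \<or> d y z = d x y + d x z"
begin

text \<open>The four points form a rectangle with sides \<open>p\<close>, \<open>q\<close> and
  diagonals \<open>p + q\<close>. By its symmetries let \<open>A\<close> be farthest from
  \<open>v\<close> and put a = \<open>d A v\<close>. Then \<open>B\<close>, \<open>D\<close>,
  \<open>C\<close> have distances |a - p|, |a - q|, |a - (p + q)| from \<open>v\<close>. The first
  two differ by at most |p - q| < p + q, so they add up to p + q. As a > 0, this forces a = p + q,
  so \<open>d C v = 0\<close>, against \<open>pos\<close>.\<close>

lemma pseudolinear_maximal:
  assumes T: "A \<in> T" "B \<in> T" "C \<in> T" "D \<in> T" "v \<in> T"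
    and "p > 0" "q > 0" "d A B = p" "d C D = p" "d B C = q" "d A D = q" "d A C = p + q" "d B D = p + q"
  shows "v \<in> {A, B, C, D}"
proof (rule ccontr)
  assume v: "v \<notin> {A, B, C, D}"
  have "d A v > 0" "d B v > 0" "d C v > 0" "d D v > 0"
    using v T by (auto intro: pos)
  moreover note lin[OF T(1,2,5)] lin[OF T(1,3,5)] lin[OF T(1,4,5)] lin[OF T(2,3,5)] lin[OF T(2,4,5)]
    lin[OF T(3,4,5)]
  ultimately show False using assms(6-) by (smt (verit))
qed

text \<open>A pair at which the coordinate fails forms with the two base points a rectangle as in
  \<open>pseudolinear_maximal\<close>, which then exhausts \<open>T\<close>. Here \<open>x\<close>
  is the diagonal, in the labelling of \<open>exceptional_quadruple\<close>.\<close>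

theorem menger_line:
  "(\<exists>f. \<forall>x\<in>T. \<forall>y\<in>T. d x y = \<bar>f x - f y\<bar>) \<or>
   (\<exists>A B C D x y. 0 < y \<and> y < x \<and> T = {A, B, C, D} \<and> d A B = x \<and> d C D = x \<and>
      d A D = y \<and> d B C = y \<and> d A C = x - y \<and> d B D = x - y)"
proof (cases "\<exists>a\<in>T. \<exists>b\<in>T. a \<noteq> b")
  case False
  then have "\<forall>x\<in>T. \<forall>y\<in>T. d x y = \<bar>0 - 0\<bar>" by (metis refl abs_0 diff_self)
  then show ?thesis by (intro disjI1 exI[of _ "\<lambda>_. 0"])
next
  case True
  then obtain a b where ab: "a \<in> T" "b \<in> T" "a \<noteq> b" by blast
  \<comment> \<open>\<open>f\<close> is the only candidate coordinate with \<open>a\<close> at \<open>0\<close> and \<open>b\<close> at \<open>d a b\<close>. If it fails for \<open>t\<close> and \<open>u\<close>, then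
    \<open>d t u\<close> is both \<open>\<bar>f t + f u\<bar>\<close> and \<open>\<bar>f t + f u - 2 * d a b\<bar>\<close>, so \<open>f t + f u = d a b\<close>.\<close>
  define f where "f t = (if d b t = d a b + d a t then - d a t else d a t)" for t
  have L: "d a b > 0" by (rule pos[OF ab])
  have nn: "0 \<le> d s t" if "s \<in> T" "t \<in> T" for s t
    using pos[OF that] refl[OF that(1)] by (cases "s = t") auto
  have fa: "d a t = \<bar>f t\<bar>" and fb: "d b t = \<bar>f t - d a b\<bar>" if t: "t \<in> T" for t
    using lin[OF ab(1,2) t] nn[OF ab(1) t] nn[OF ab(2) t] L unfolding f_def by (auto split: if_splits)
  show ?thesis
  proof (cases "\<forall>t\<in>T. \<forall>u\<in>T. d t u = \<bar>f t - f u\<bar>")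
    case True
    then show ?thesis by blast
  next
    case False
    then obtain t u where tu: "t \<in> T" "u \<in> T" "d t u \<noteq> \<bar>f t - f u\<bar>" by blast
    have s: "f u = d a b - f t" "d t u = d a b"
      using lin[OF ab(1) tu(1,2)] lin[OF ab(2) tu(1,2)] tu(3) L nn[OF tu(1,2)]
      unfolding fa[OF tu(1)] fa[OF tu(2)] fb[OF tu(1)] fb[OF tu(2)] by (smt (verit))+
    have ne: "f t \<noteq> 0" "f t \<noteq> d a b" using s tu(3) L by auto
    note dist = s(2) fa[OF tu(1)] fa[OF tu(2)] fb[OF tu(1)] fb[OF tu(2)]
      sym[OF tu(1,2)] sym[OF tu(1) ab(1)] sym[OF tu(1) ab(2)] sym[OF tu(2) ab(1)] sym[OF tu(2) ab(2)] sym[OF ab(1,2)]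
    have fin: ?thesis if T: "A \<in> T" "B \<in> T" "C \<in> T" "D \<in> T" and "0 < y" "y < x"
       and d: "d A B = x" "d C D = x" "d A D = y" "d B C = y" "d A C = x - y" "d B D = x - y"
     for A B C D x y
    proof -
      \<comment> \<open>The pairs at distance \<open>x\<close> are the diagonals, hence the cyclic
        order \<open>A\<close>, \<open>C\<close>, \<open>B\<close>, \<open>D\<close>.\<close>
      have "v \<in> {A, C, B, D}" if "v \<in> T" for v
        by (rule pseudolinear_maximal[OF T(1,3,2,4) that, of "x - y" y])
          (use that sym[OF T(3,2)] \<open>0 < y\<close> \<open>y < x\<close> d in auto)
      then have "T = {A, B, C, D}" using T by blast
      then show ?thesis using \<open>0 < y\<close> \<open>y < x\<close> d by blast
    qed
    \<comment> \<open>Opposite pairs have the common distances \<open>d a b\<close>, |f t| and |d a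
      b - f t|. The position of \<open>f t\<close> decides which one is the sum of the others and
      serves as \<open>x\<close>; the instances of \<open>fin\<close> list \<open>y\<close> before
      \<open>x\<close>.\<close>
    consider "f t < 0" | "0 < f t" "f t < d a b" | "d a b < f t"
      using ne by linarith
    then show ?thesis
    proof cases
      case 1
      show ?thesis
        by (rule fin[of a u t b "d a b" "d a u"]) (use 1 ab tu(1,2) L dist s(1) in auto)
    next
      case 2
      show ?thesis
        by (rule fin[of a b u t "d a t" "d a b"]) (use 2 ab tu(1,2) L dist s(1) in auto)
    next
      case 3
      show ?thesis
        by (rule fin[of a t u b "d a b" "d a t"]) (use 3 ab tu(1,2) L dist s(1) in auto)
    qed
  qed
qed

end

section \<open>Unit vectors, projections and hyperbolic cosines\<close>

lemma abs_inner_less_one: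
  fixes x y :: "'a::real_inner"
  assumes "norm x = 1" "norm y = 1" "pm x \<noteq> pm y"
  shows "\<bar>x \<bullet> y\<bar> < 1"
proof -
  have "\<bar>x \<bullet> y\<bar> \<noteq> norm x * norm y"
    using assms norm_cauchy_schwarz_abs_eq[of x y] by (auto simp: pm_eq_iff)
  then show ?thesis using Cauchy_Schwarz_ineq2[of x y] assms by simp
qed

lemma abs_inner_le_one:
  fixes x y :: "'a::real_inner"
  assumes "norm x = 1" "norm y = 1"
  shows "\<bar>x \<bullet> y\<bar> \<le> 1"
  using Cauchy_Schwarz_ineq2[of x y] assms by simp

lemma proj_spaceE:
  assumes "p \<in> proj_space UNIV"
  obtains x where "p = pm x" "norm x = 1"
  using assms by (auto simp: proj_space_eq)

text \<open>Injectivity is automatic: distinct points have |x . y| < 1 and so positive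
  \<open>rho\<close>.\<close>

lemma isometric_image:
  assumes T: "T \<subseteq> proj_space UNIV"
    and f: "\<And>p q. p \<in> T \<Longrightarrow> q \<in> T \<Longrightarrow> rho (f p) (f q) = rho p q"
  shows "isometric T (f ` T)"
proof -
  have "p = q" if pq: "p \<in> T" "q \<in> T" "f p = f q" for p q
  proof (rule ccontr)
    assume ne: "p \<noteq> q"
    obtain x where x: "p = pm x" "norm x = 1" using T pq(1) by (blast elim: proj_spaceE)
    obtain y where y: "q = pm y" "norm y = 1" using T pq(2) by (blast elim: proj_spaceE)
    have "arccos \<bar>x \<bullet> y\<bar> = arccos \<bar>x \<bullet> x\<bar>"
      using f[OF pq(1,1)] f[OF pq(1,2)] pq(3) unfolding x y rho_pm by simp
    moreover have "x \<bullet> x = 1" using x(2) by (simp add: dot_square_norm)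
    moreover have "\<bar>x \<bullet> y\<bar> < 1"
      using abs_inner_less_one[OF x(2) y(2)] ne x(1) y(1) by simp
    ultimately show False using arccos_eq_0_iff[of "\<bar>x \<bullet> y\<bar>"] by simp
  qed
  then have "inj_on f T" by (rule inj_onI)
  then show ?thesis unfolding isometric_def using f by (blast intro: inj_on_imp_bij_betw)
qed

text \<open>Injectivity of \<open>arccos\<close> on [-1, 1] turns invariance into equality of
  absolute inner products; squaring removes signs and roots, and expanding gives the symmetric
  form.\<close>

lemma projection_identity:
  fixes s x y :: "'a::real_inner"
  assumes n: "norm s = 1" "norm x = 1" "norm y = 1" and ne: "pm x \<noteq> pm s" "pm y \<noteq> pm s"
    and inv: "rho (sph_proj (pm s) (pm x)) (sph_proj (pm s) (pm y)) = rho (pm x) (pm y)"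
  shows "(s \<bullet> x)\<^sup>2 * (s \<bullet> y)\<^sup>2 + (s \<bullet> y)\<^sup>2 * (x \<bullet> y)\<^sup>2 + (x \<bullet> y)\<^sup>2 * (s \<bullet> x)\<^sup>2 =
    2 * ((s \<bullet> x) * (s \<bullet> y) * (x \<bullet> y)) + (s \<bullet> x)\<^sup>2 * (s \<bullet> y)\<^sup>2 * (x \<bullet> y)\<^sup>2"
proof -
  define g where "g z = (z - (s \<bullet> z) *\<^sub>R s) /\<^sub>R sqrt (1 - (s \<bullet> z)\<^sup>2)" for z
  have unit: "s \<bullet> s = 1" "x \<bullet> x = 1" "y \<bullet> y = 1"
    using n by (simp_all add: dot_square_norm)
  have p: "0 < 1 - (s \<bullet> x)\<^sup>2" "0 < 1 - (s \<bullet> y)\<^sup>2"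
    using abs_inner_less_one[of s x] abs_inner_less_one[of s y] n ne
    by (auto simp: abs_square_less_1)
  have gg: "g z \<bullet> g w = (z \<bullet> w - (s \<bullet> z) * (s \<bullet> w)) / (sqrt (1 - (s \<bullet> z)\<^sup>2) * sqrt (1 - (s \<bullet> w)\<^sup>2))" for z w
    unfolding g_def
    by (simp add: inner_diff_left inner_diff_right unit inner_commute[of z s] divide_inverse mult_ac)
  have "norm (g x) = 1" "norm (g y) = 1"
    using p unfolding norm_eq_sqrt_inner gg by (simp_all add: unit power2_eq_square)
  then have "\<bar>g x \<bullet> g y\<bar> = \<bar>x \<bullet> y\<bar>"
    using inv arccos_eq_iff[of "\<bar>g x \<bullet> g y\<bar>" "\<bar>x \<bullet> y\<bar>"] n
    by (simp add: sph_proj_pm rho_pm abs_inner_le_one flip: g_def)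
  then have "(g x \<bullet> g y)\<^sup>2 = (x \<bullet> y)\<^sup>2" by (simp add: power2_eq_iff abs_eq_iff)
  then have "(x \<bullet> y - (s \<bullet> x) * (s \<bullet> y))\<^sup>2 = (x \<bullet> y)\<^sup>2 * ((1 - (s \<bullet> x)\<^sup>2) * (1 - (s \<bullet> y)\<^sup>2))"
    using p unfolding gg
    by (simp only: power_divide power_mult_distrib real_sqrt_pow2 less_imp_le)
      (simp add: nonzero_divide_eq_eq)
  then show ?thesis by (simp add: power2_eq_square algebra_simps)
qed

text \<open>Clearing denominators gives A^2 + B^2 + C^2 = 2ABC + 1, a quadratic equation for C with
  roots cosh (\<alpha> + \<beta>) and cosh (\<alpha> - \<beta>).\<close>

lemma cosh_triple_linear:
  fixes \<alpha> \<beta> \<gamma> a b c :: real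
  assumes nn: "0 \<le> \<alpha>" "0 \<le> \<beta>" "0 \<le> \<gamma>"
    and abc: "a = 1 / cosh \<alpha>" "b = 1 / cosh \<beta>" "c = 1 / cosh \<gamma>"
    and id: "a\<^sup>2 * b\<^sup>2 + b\<^sup>2 * c\<^sup>2 + c\<^sup>2 * a\<^sup>2 = 2 * (a * b * c) + a\<^sup>2 * b\<^sup>2 * c\<^sup>2"
  shows "\<gamma> = \<alpha> + \<beta> \<or> \<alpha> = \<gamma> + \<beta> \<or> \<beta> = \<alpha> + \<gamma>"
proof -
  define A B C where "A = cosh \<alpha>" and "B = cosh \<beta>" and "C = cosh \<gamma>"
  have p: "A > 0" "B > 0" "C > 0" by (simp_all add: A_def B_def C_def)
  have "A\<^sup>2 + B\<^sup>2 + C\<^sup>2 = 2 * (A * B * C) + 1"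
    using id p unfolding abc A_def[symmetric] B_def[symmetric] C_def[symmetric]
    by (simp add: field_simps power2_eq_square)
  then have "(C - A * B)\<^sup>2 = (A\<^sup>2 - 1) * (B\<^sup>2 - 1)"
    by (simp add: power2_eq_square algebra_simps)
  also have "\<dots> = (sinh \<alpha> * sinh \<beta>)\<^sup>2"
    by (simp add: A_def B_def sinh_square_eq power_mult_distrib)
  finally have "C = A * B + sinh \<alpha> * sinh \<beta> \<or> C = A * B - sinh \<alpha> * sinh \<beta>"
    by (auto simp: power2_eq_iff)
  then have "cosh \<gamma> = cosh (\<alpha> + \<beta>) \<or> cosh \<gamma> = cosh (\<alpha> - \<beta>)"
    by (simp add: A_def B_def C_def cosh_add cosh_diff)
  then show ?thesis using nn by auto
qed

section \<open>Realising finite configurations in \<open>ell2\<close>\<close>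

text \<open>Parseval's identity without normalisation. Both sides are linear in \<open>x\<close>, so
  checking \<open>x\<close> in \<open>C\<close> suffices. A zero vector in \<open>C\<close>
  contributes 0 / 0 = 0, as it should.\<close>

lemma orthogonal_expansion:
  fixes x y :: "'a::real_inner"
  assumes C: "finite C" "pairwise orthogonal C" and x: "x \<in> span C"
  shows "(\<Sum>c\<in>C. (x \<bullet> c) * (y \<bullet> c) / (c \<bullet> c)) = x \<bullet> y"
  using x
proof (rule span_induct)
  show "subspace {x. (\<Sum>c\<in>C. (x \<bullet> c) * (y \<bullet> c) / (c \<bullet> c)) = x \<bullet> y}"
    by (auto simp: subspace_def inner_add_left distrib_right add_divide_distrib sum.distrib
        mult.assoc simp flip: sum_distrib_left times_divide_eq_right)
  fix e assume e: "e \<in> C"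
  have "(\<Sum>c\<in>C. (e \<bullet> c) * (y \<bullet> c) / (c \<bullet> c)) = (\<Sum>c\<in>C. if c = e then e \<bullet> y else 0)"
    using C(2) e by (intro sum.cong) (auto simp: pairwise_def orthogonal_def inner_commute)
  then show "(\<Sum>c\<in>C. (e \<bullet> c) * (y \<bullet> c) / (c \<bullet> c)) = e \<bullet> y" using C(1) e by simp
qed

text \<open>Coordinates along an orthogonal spanning set, padded with zeros, preserve the Gram
  matrix.\<close>

lemma ell2_embedding:
  fixes B :: "'a::real_inner set"
  assumes "finite B"
  obtains \<phi> :: "'a \<Rightarrow> ell2" where "\<And>x y. x \<in> B \<Longrightarrow> y \<in> B \<Longrightarrow> \<phi> x \<bullet> \<phi> y = x \<bullet> y"
proof -
  obtain C where C: "finite C" "span C = span B" "pairwise orthogonal C"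
    using basis_orthogonal[OF assms] by blast
  obtain e where e: "bij_betw e {0..<card C} C" using ex_bij_betw_nat_finite[OF C(1)] by blast
  define s where "s x n = (if n < card C then (x \<bullet> e n) / norm (e n) else 0)" for x n
  define \<phi> where "\<phi> x = Ell2 (s x)" for x
  have seq: "seq_of (\<phi> x) = s x" for x
    unfolding \<phi>_def
    by (rule Ell2_inverse) (auto simp: s_def intro!: summable_finite[of "{0..<card C}"])
  have "\<phi> x \<bullet> \<phi> y = x \<bullet> y" if x: "x \<in> B" for x y
  proof -
    have "\<phi> x \<bullet> \<phi> y = (\<Sum>n=0..<card C. s x n * s y n)"
      unfolding inner_ell2_def seq by (rule suminf_finite) (auto simp: s_def)
    also have "\<dots> = (\<Sum>n=0..<card C. (x \<bullet> e n) * (y \<bullet> e n) / (e n \<bullet> e n))"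
      by (rule sum.cong) (auto simp: s_def dot_square_norm power2_eq_square)
    also have "\<dots> = (\<Sum>c\<in>C. (x \<bullet> c) * (y \<bullet> c) / (c \<bullet> c))"
      by (rule sum.reindex_bij_betw[OF e])
    also have "\<dots> = x \<bullet> y"
      using orthogonal_expansion[OF C(1,3)] C(2) span_base[OF x] by blast
    finally show ?thesis .
  qed
  then show thesis using that by blast
qed

section \<open>A single class of non-orthogonal points\<close>

text \<open>The representatives \<open>k p\<close> are chosen with positive inner products because
  an exceptional quadruple prescribes signs, which \<open>rho\<close> does not see.\<close>

lemma helix_or_exceptional:
  fixes T :: "'a::real_inner set set" and k :: "'a set \<Rightarrow> 'a"
  assumes T: "T \<subseteq> proj_space UNIV"
    and k: "\<And>p. p \<in> T \<Longrightarrow> p = pm (k p)" "\<And>p. p \<in> T \<Longrightarrow> norm (k p) = 1"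
      "\<And>p q. p \<in> T \<Longrightarrow> q \<in> T \<Longrightarrow> 0 < k p \<bullet> k q"
    and id: "\<And>s x y. s \<in> T \<Longrightarrow> x \<in> T \<Longrightarrow> y \<in> T \<Longrightarrow>
      (k s \<bullet> k x)\<^sup>2 * (k s \<bullet> k y)\<^sup>2 + (k s \<bullet> k y)\<^sup>2 * (k x \<bullet> k y)\<^sup>2 + (k x \<bullet> k y)\<^sup>2 * (k s \<bullet> k x)\<^sup>2 =
      2 * ((k s \<bullet> k x) * (k s \<bullet> k y) * (k x \<bullet> k y)) + (k s \<bullet> k x)\<^sup>2 * (k s \<bullet> k y)\<^sup>2 * (k x \<bullet> k y)\<^sup>2"
  shows "(\<exists>K :: ell2 set set. is_helix K \<and> (\<exists>U\<subseteq>K. isometric T U)) \<or>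
    (\<exists>Q :: ell2 set set. exceptional_quadruple Q \<and> isometric T Q)"
proof -
  define d where "d p q = arcosh (1 / (k p \<bullet> k q))" for p q
  have kk: "k p \<bullet> k p = 1" if "p \<in> T" for p using k(2)[OF that] by (simp add: dot_square_norm)
  have ge: "1 \<le> 1 / (k p \<bullet> k q)" if "p \<in> T" "q \<in> T" for p q
    using k(3)[OF that] abs_inner_le_one[OF k(2)[OF that(1)] k(2)[OF that(2)]] by simp
  have cosh_d: "k p \<bullet> k q = 1 / cosh (d p q)" if "p \<in> T" "q \<in> T" for p q
    using ge[OF that] by (simp add: d_def)
  have d_nonneg: "0 \<le> d p q" if "p \<in> T" "q \<in> T" for p q
    unfolding d_def using ge[OF that] by simp
  have d_sym: "d p q = d q p" for p q by (simp add: d_def inner_commute)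
  have rho_d: "rho p q = arccos (1 / cosh (d p q))" if "p \<in> T" "q \<in> T" for p q
    using k(1)[OF that(1)] k(1)[OF that(2)] rho_pm[of "k p" "k q"] cosh_d[OF that] k(3)[OF that]
    by simp
  interpret linear_triples T d
  proof
    fix x y assume xy: "x \<in> T" "y \<in> T"
    show "d x x = 0" using xy kk by (simp add: d_def)
    show "d x y = d y x" by (rule d_sym)
    show "0 < d x y" if "x \<noteq> y"
    proof -
      have "pm (k x) \<noteq> pm (k y)" using that k(1)[OF xy(1)] k(1)[OF xy(2)] by simp
      then have "k x \<bullet> k y \<noteq> 1" using abs_inner_less_one k(2) xy by fastforce
      then show ?thesis using ge[OF xy] unfolding d_def by simp
    qed
    fix z assume z: "z \<in> T"
    show "d x z = d x y + d y z \<or> d x y = d x z + d y z \<or> d y z = d x y + d x z"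
      \<comment> \<open>Centring the identity at \<open>y\<close> matches its terms with the pairs
        xy, yz, xz.\<close>
      using cosh_triple_linear[OF d_nonneg[OF xy] d_nonneg[OF xy(2) z] d_nonneg[OF xy(1) z]
          cosh_d[OF xy] cosh_d[OF xy(2) z] cosh_d[OF xy(1) z]] id[OF xy(2,1) z]
      by (simp add: inner_commute[of "k y" "k x"] ac_simps)
  qed
  consider (line) f where "\<forall>p\<in>T. \<forall>q\<in>T. d p q = \<bar>f p - f q\<bar>"
    | (quad) A B C D x y where "0 < y" "y < x" "T = {A, B, C, D}" "d A B = x" "d C D = x"
      "d A D = y" "d B C = y" "d A C = x - y" "d B D = x - y"
    using menger_line by blast
  then show ?thesis
  proof cases
    case line
    obtain K :: "ell2 set set" where K: "is_helix K" using helix_exists by blast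
    obtain h where h: "K = range h" "inj h"
      "\<And>s t. rho (h s) (h t) = arccos (1 / cosh (t - s))"
      by (rule is_helixE[OF K]) (rule that)
    have "rho (h (f p)) (h (f q)) = rho p q" if "p \<in> T" "q \<in> T" for p q
    proof -
      have "cosh (f q - f p) = cosh (d p q)"
        using line that by (simp add: abs_minus_commute)
      then show ?thesis using rho_d[OF that] by (simp only: h(3))
    qed
    then have "isometric T ((\<lambda>p. h (f p)) ` T)" by (rule isometric_image[OF T])
    moreover have "(\<lambda>p. h (f p)) ` T \<subseteq> K" using h(1) by auto
    ultimately show ?thesis using K by (intro disjI1 exI[of _ K] conjI exI)
  next
    case quad
    obtain \<phi> :: "'a \<Rightarrow> ell2" where \<phi>: "\<And>x y. x \<in> k ` T \<Longrightarrow> y \<in> k ` T \<Longrightarrow> \<phi> x \<bullet> \<phi> y = x \<bullet> y"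
      using ell2_embedding[of "k ` T"] quad(3) by auto
    have ip: "\<phi> (k p) \<bullet> \<phi> (k q) = k p \<bullet> k q" if "p \<in> T" "q \<in> T" for p q
      using \<phi> that by blast
    have sph: "\<phi> (k p) \<in> sphere 0 1" if "p \<in> T" for p
      using ip[OF that that] kk[OF that] by (simp add: norm_eq_sqrt_inner)
    let ?g = "\<lambda>p. pm (\<phi> (k p))"
    have "isometric T (?g ` T)"
    proof (rule isometric_image[OF T])
      fix p q assume "p \<in> T" "q \<in> T"
      then show "rho (?g p) (?g q) = rho p q"
        using rho_pm[of "k p" "k q"] k(1) ip by (simp add: rho_pm)
    qed
    moreover have "exceptional_quadruple (?g ` T)"
    proof -
      have T4: "A \<in> T" "B \<in> T" "C \<in> T" "D \<in> T" using quad(3) by auto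
      note sph4 = T4[THEN sph]
      have gram: "\<phi> (k A) \<bullet> \<phi> (k B) = 1 / cosh x" "\<phi> (k C) \<bullet> \<phi> (k D) = 1 / cosh x"
        "\<phi> (k A) \<bullet> \<phi> (k D) = 1 / cosh y" "\<phi> (k B) \<bullet> \<phi> (k C) = 1 / cosh y"
        "\<phi> (k A) \<bullet> \<phi> (k C) = 1 / cosh (x - y)" "\<phi> (k B) \<bullet> \<phi> (k D) = 1 / cosh (x - y)"
        using quad(4-) T4 by (simp_all add: ip cosh_d)
      have "?g ` T = {?g A, ?g B, ?g C, ?g D}" using quad(3) by simp
      moreover have "0 < x" "0 < y" "x \<noteq> y" using quad(1,2) by auto
      ultimately show ?thesis
        unfolding exceptional_quadruple_def
        using pos_semidef_exc_gram[OF sph4 gram] sph4 gram by blast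
    qed
    ultimately show ?thesis by (intro disjI2 exI conjI)
  qed
qed

section \<open>Decomposition into orthogonal classes\<close>

theorem theorem1p6:
  fixes S :: "'a::{real_inner, complete_space} set set"
  assumes "S \<subseteq> proj_space UNIV"
    and "proj_invariant S"
  shows "\<exists>P. \<Union>P = S \<and> disjoint P \<and>
           (\<forall>T\<in>P. \<forall>U\<in>P. T \<noteq> U \<longrightarrow> orthogonal_sets T U) \<and>
           (\<forall>T\<in>P. (\<exists>K :: ell2 set set. is_helix K \<and> (\<exists>U\<subseteq>K. isometric T U)) \<or>
                  (\<exists>Q :: ell2 set set. exceptional_quadruple Q \<and> isometric T Q))"
proof -
  have "\<exists>x. p = pm x \<and> norm x = 1" if "p \<in> S" for p
    using assms(1) that by (blast elim: proj_spaceE)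
  then obtain r where r: "\<And>p. p \<in> S \<Longrightarrow> p = pm (r p)" "\<And>p. p \<in> S \<Longrightarrow> norm (r p) = 1"
    by metis
  have rr: "r p \<bullet> r p = 1" if "p \<in> S" for p using r(2)[OF that] by (simp add: dot_square_norm)
  have id: "(r s \<bullet> r x)\<^sup>2 * (r s \<bullet> r y)\<^sup>2 + (r s \<bullet> r y)\<^sup>2 * (r x \<bullet> r y)\<^sup>2 + (r x \<bullet> r y)\<^sup>2 * (r s \<bullet> r x)\<^sup>2 =
      2 * ((r s \<bullet> r x) * (r s \<bullet> r y) * (r x \<bullet> r y)) + (r s \<bullet> r x)\<^sup>2 * (r s \<bullet> r y)\<^sup>2 * (r x \<bullet> r y)\<^sup>2"
    if S: "s \<in> S" "x \<in> S" "y \<in> S" for s x y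
  \<comment> \<open>Invariance says nothing at the centre \<open>s\<close>, but there the identity
    follows from \<open>r s \<bullet> r s = 1\<close>.\<close>
  proof (cases "x = s \<or> y = s")
    case True
    then show ?thesis using S by (auto simp: rr inner_commute power2_eq_square algebra_simps)
  next
    case False
    have "rho (sph_proj s x) (sph_proj s y) = rho x y"
      using assms(2) S False unfolding proj_invariant_def by blast
    then show ?thesis
      using projection_identity[OF r(2)[OF S(1)] r(2)[OF S(2)] r(2)[OF S(3)]] False
      by (simp flip: r(1)[OF S(1)] r(1)[OF S(2)] r(1)[OF S(3)])
  qed
  define E where "E = {(p, q). p \<in> S \<and> q \<in> S \<and> r p \<bullet> r q \<noteq> 0}"
  have "equiv S E"
  proof (rule equivI)
    show "E \<subseteq> S \<times> S" by (auto simp: E_def)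
    show "refl_on S E" by (auto simp: refl_on_def E_def rr)
    show "sym E" by (auto simp: sym_def E_def inner_commute)
    \<comment> \<open>If this product vanished, the identity would leave only (pq)^2 (qs)^2 =
      0.\<close>
    have "r p \<bullet> r s \<noteq> 0" if "p \<in> S" "q \<in> S" "s \<in> S" "r p \<bullet> r q \<noteq> 0" "r q \<bullet> r s \<noteq> 0" for p q s
      using id[OF that(1-3)] that(4,5) by auto
    then show "trans E" unfolding trans_def E_def by blast
  qed
  show ?thesis
  proof (intro exI conjI ballI impI)
    show "\<Union> (S // E) = S" by (rule Union_quotient[OF \<open>equiv S E\<close>])
    show "disjoint (S // E)"
      using quotient_disj[OF \<open>equiv S E\<close>] by (auto simp: disjoint_def)
    show "orthogonal_sets T U" if TU: "T \<in> S // E" "U \<in> S // E" "T \<noteq> U" for T U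
      unfolding orthogonal_sets_def
    proof (intro ballI)
      fix p q u v assume pq: "p \<in> T" "q \<in> U" and uv: "u \<in> p" "v \<in> q"
      have S: "p \<in> S" "q \<in> S" using pq TU in_quotient_imp_subset[OF \<open>equiv S E\<close>] by blast+
      have "(p, q) \<notin> E" using quotient_eq_iff[OF \<open>equiv S E\<close> TU(1,2) pq] TU(3) by simp
      then have "r p \<bullet> r q = 0" using S by (simp add: E_def)
      moreover have "u = r p \<or> u = - r p" "v = r q \<or> v = - r q"
        using uv r(1)[OF S(1)] r(1)[OF S(2)] unfolding pm_def by blast+
      ultimately show "u \<bullet> v = 0" by auto
    qed
    fix T assume T: "T \<in> S // E"
    then obtain a where a: "a \<in> S" "T = E `` {a}" by (blast elim: quotientE)
    have TS: "p \<in> S" if "p \<in> T" for p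
      using T in_quotient_imp_subset[OF \<open>equiv S E\<close>] that by blast
    have ra: "r a \<bullet> r p \<noteq> 0" if "p \<in> T" for p using that a by (auto simp: E_def)
    \<comment> \<open>The sign makes \<open>k p\<close> have positive inner product with
      \<open>r a\<close>.\<close>
    define k where "k p = sgn (r a \<bullet> r p) *\<^sub>R r p" for p
    have k: "k p = r p \<or> k p = - r p" if "p \<in> T" for p
      using ra[OF that] by (auto simp: k_def sgn_real_def)
    show "(\<exists>K :: ell2 set set. is_helix K \<and> (\<exists>U\<subseteq>K. isometric T U)) \<or>
      (\<exists>Q :: ell2 set set. exceptional_quadruple Q \<and> isometric T Q)"
    proof (rule helix_or_exceptional)
      show "T \<subseteq> proj_space UNIV" using TS assms(1) by blast
      fix p assume p: "p \<in> T"
      show "p = pm (k p)" using k[OF p] r(1)[OF TS[OF p]] by (metis pm_eq_iff)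
      show "norm (k p) = 1" using k[OF p] r(2)[OF TS[OF p]] by auto
      fix q assume q: "q \<in> T"
      have pq: "r p \<bullet> r q \<noteq> 0"
        using quotient_eq_iff[OF \<open>equiv S E\<close> T T p q] by (simp add: E_def)
      \<comment> \<open>By \<open>id\<close> this sum is twice the product of the three inner
        products. Its positivity makes the signs chosen relative to \<open>r a\<close> consistent
        for \<open>p\<close> and \<open>q\<close>.\<close>
      have "0 < (r a \<bullet> r p)\<^sup>2 * (r a \<bullet> r q)\<^sup>2 * (1 - (r p \<bullet> r q)\<^sup>2) +
          (r a \<bullet> r q)\<^sup>2 * (r p \<bullet> r q)\<^sup>2 + (r p \<bullet> r q)\<^sup>2 * (r a \<bullet> r p)\<^sup>2"
        using ra[OF p] ra[OF q] pq abs_inner_le_one[OF r(2)[OF TS[OF p]] r(2)[OF TS[OF q]]]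
        by (intro add_nonneg_pos mult_nonneg_nonneg add_nonneg_nonneg mult_pos_pos)
          (auto simp: abs_square_le_1)
      then have "0 < (r a \<bullet> r p) * (r a \<bullet> r q) * (r p \<bullet> r q)"
        using id[OF a(1) TS[OF p] TS[OF q]] by (simp add: algebra_simps)
      then show "0 < k p \<bullet> k q"
        by (auto simp: k_def sgn_real_def zero_less_mult_iff mult_less_0_iff)
    next
      \<comment> \<open>Sign changes preserve the identity: each vector occurs twice in the triple
        product.\<close>
      fix s x y assume "s \<in> T" "x \<in> T" "y \<in> T"
      then show "(k s \<bullet> k x)\<^sup>2 * (k s \<bullet> k y)\<^sup>2 + (k s \<bullet> k y)\<^sup>2 * (k x \<bullet> k y)\<^sup>2 + (k x \<bullet> k y)\<^sup>2 * (k s \<bullet> k x)\<^sup>2 =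
        2 * ((k s \<bullet> k x) * (k s \<bullet> k y) * (k x \<bullet> k y)) + (k s \<bullet> k x)\<^sup>2 * (k s \<bullet> k y)\<^sup>2 * (k x \<bullet> k y)\<^sup>2"
        using k[of s] k[of x] k[of y] id[OF TS TS TS, of s x y] by auto
    qed
  qed
qed

end
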